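(* Let $X$ be an irreducible sofic shift and let $\phi:X\to Y$ be a factor code onto a shift space $Y$. Then $\phi$ is semi-open.
   Context: Shift spaces are closed shift-invariant subsets of full shifts over finite alphabets. A code $\phi:X\to Y$ between shift spaces is a sliding block code (equivalently, a continuous map commuting with the shifts); a factor code is an onto code. A shift space is sofic if it is the set of label sequences of bi-infinite paths of a finite labeled directed graph; it is irreducible if for all words $u,v$ in its language there is $w$ with $uwv$ in its language. A map is semi-open if the image of every non-empty open set has non-empty interior. *)

theory Defs
  imports "HOL-Analysis.Analysis" "Graph_Theory.Digraph"
begin

definition shift :: "(int \<Rightarrow> 'a) \<Rightarrow> int \<Rightarrow> 'a" where
  "shift x = (\<lambda>i. x (i + 1))"

(* The full shift over the alphabet A: its underlying set is the set of all x with
   x i \<in> A for every i, with the product of the discrete topologies. *)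
definition full_shift :: "'a set \<Rightarrow> (int \<Rightarrow> 'a) topology" where
  "full_shift A = product_topology (\<lambda>_. discrete_topology A) UNIV"

(* Shift-invariance of a two-sided shift space is the equality, not just the inclusion
   of the image of X in X. The empty shift space is allowed. *)
definition shift_space :: "'a set \<Rightarrow> (int \<Rightarrow> 'a) set \<Rightarrow> bool" where
  "shift_space A X \<longleftrightarrow> finite A \<and> closedin (full_shift A) X \<and> shift ` X = X"

(* The word x i, x (i + 1), ..., x (i + n - 1). *)
definition block :: "(int \<Rightarrow> 'a) \<Rightarrow> int \<Rightarrow> nat \<Rightarrow> 'a list" where
  "block x i n = map (\<lambda>k. x (i + int k)) [0..<n]"

definition language :: "(int \<Rightarrow> 'a) set \<Rightarrow> 'a list set" where
  "language X = {block x i n | x i n. x \<in> X}"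

definition irreducible_shift :: "(int \<Rightarrow> 'a) set \<Rightarrow> bool" where
  "irreducible_shift X \<longleftrightarrow>
     (\<forall>u \<in> language X. \<forall>v \<in> language X. \<exists>w. u @ w @ v \<in> language X)"

(* A bi-infinite path is given by its sequence of arcs. *)
definition biinfinite_path :: "('v, 'e) pre_digraph \<Rightarrow> (int \<Rightarrow> 'e) \<Rightarrow> bool" where
  "biinfinite_path G e \<longleftrightarrow>
     (\<forall>i. e i \<in> arcs G \<and> head G (e i) = tail G (e (i + 1)))"

(* fin_digraph allows loops and parallel arcs. Every finite directed graph is isomorphic
   to one whose vertices and arcs are natural numbers, so fixing these types is no
   restriction. *)
definition sofic :: "(int \<Rightarrow> 'a) set \<Rightarrow> bool" where
  "sofic X \<longleftrightarrow>
     (\<exists>(G :: (nat, nat) pre_digraph) (lab :: nat \<Rightarrow> 'a).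
        fin_digraph G \<and> X = {lab \<circ> e | e. biinfinite_path G e})"

(* Sliding block codes with memory m and anticipation n. The values of \<phi> outside X are
   irrelevant. *)
definition code :: "(int \<Rightarrow> 'a) set \<Rightarrow> (int \<Rightarrow> 'b) set \<Rightarrow> ((int \<Rightarrow> 'a) \<Rightarrow> int \<Rightarrow> 'b) \<Rightarrow> bool" where
  "code X Y \<phi> \<longleftrightarrow> \<phi> ` X \<subseteq> Y \<and>
     (\<exists>(m :: nat) (n :: nat) (\<Phi> :: 'a list \<Rightarrow> 'b).
        \<forall>x \<in> X. \<forall>i. \<phi> x i = \<Phi> (block x (i - int m) (m + n + 1)))"

definition factor_code :: "(int \<Rightarrow> 'a) set \<Rightarrow> (int \<Rightarrow> 'b) set \<Rightarrow> ((int \<Rightarrow> 'a) \<Rightarrow> int \<Rightarrow> 'b) \<Rightarrow> bool" where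
  "factor_code X Y \<phi> \<longleftrightarrow> code X Y \<phi> \<and> \<phi> ` X = Y"

definition semi_open_map :: "'a topology \<Rightarrow> 'b topology \<Rightarrow> ('a \<Rightarrow> 'b) \<Rightarrow> bool" where
  "semi_open_map S T f \<longleftrightarrow>
     (\<forall>U. openin S U \<and> U \<noteq> {} \<longrightarrow> T interior_of (f ` U) \<noteq> {})"

end

theory Submission
  imports Defs
begin

text \<open>
  The label map of an irreducible presentation of \<open>X\<close> is a continuous surjection onto \<open>X\<close>.
  Precomposing \<open>\<phi>\<close> with it reduces the theorem to a code \<open>\<pi>\<close> on an irreducible Markov shift
  \<open>P\<close> of arc sequences (\<open>semi_open_map_cancel\<close>). Such a presentation is found among the arc
  sets in which every word of \<open>X\<close> is the label of a walk (\<open>irreducible_lift\<close>): in a minimal one,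
  for each arc some word of \<open>X\<close> forces every walk with that label to use the arc, so the
  irreducibility of \<open>X\<close> connects any two arcs.

  Let \<open>\<pi>\<close> have a window of length \<open>m + n + 1\<close>, and call the arcs of \<open>e \<in> P\<close> at the positions
  \<open>-(m + n), \<dots>, 0\<close> its state. There are finitely many states, so \<open>Y\<close> is a finite union of the sets
  \<open>\<pi>(W s)\<close>, where \<open>W s\<close> consists of the points with state \<open>s\<close>. They are closed by
  compactness, so one of them has an interior point (\<open>finite_Union_closed_interior\<close>): it contains
  every point of \<open>Y\<close> that agrees with some \<open>\<pi> e0\<close> on a central interval, where
  \<open>e0 \<in> W s\<close>. Given \<open>e1\<close> in an open set \<open>V\<close>, irreducibility yields \<open>g \<in> P\<close> that
  shows a long central part of \<open>e0\<close>, then one of \<open>e1\<close>, then again one of \<open>e0\<close>. If \<open>y \<in> Y\<close>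
  agrees with \<open>\<pi> g\<close> on a long enough interval, then \<open>y\<close> has a preimage \<open>l\<close> in state \<open>s\<close> at the
  first copy of \<open>e0\<close>, and a preimage \<open>r\<close> in state \<open>s\<close> at the second. The left part of \<open>l\<close>, the
  middle of \<open>g\<close> and the right part of \<open>r\<close> fit together to a preimage of \<open>y\<close> in \<open>V\<close>. Hence
  \<open>\<pi>(V)\<close> contains a neighbourhood of \<open>\<pi> g\<close> (\<open>semi_open_map_markov_shift\<close>).
\<close>

section \<open>The topology of shift spaces\<close>

text \<open>Agreement on the central interval \<open>{-k..k}\<close>, which is empty when \<open>k\<close> is negative.\<close>

definition agree :: "int \<Rightarrow> (int \<Rightarrow> 'a) \<Rightarrow> (int \<Rightarrow> 'a) \<Rightarrow> bool" where
  "agree k x y \<longleftrightarrow> (\<forall>i. \<bar>i\<bar> \<le> k \<longrightarrow> x i = y i)"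

lemma topspace_full_shift: "topspace (full_shift A) = {x. \<forall>i. x i \<in> A}"
  by (auto simp: full_shift_def PiE_def)

lemma finite_int_abs_bound:
  fixes S :: "int set"
  assumes "finite S"
  obtains k where "\<And>i. i \<in> S \<Longrightarrow> \<bar>i\<bar> \<le> k"
proof
  show "\<bar>i\<bar> \<le> Max (insert 0 (abs ` S))" if "i \<in> S" for i
    using assms that by (intro Max_ge) auto
qed

lemma openin_shift_iff:
  assumes X: "X \<subseteq> topspace (full_shift A)"
  shows "openin (subtopology (full_shift A) X) U \<longleftrightarrow>
    U \<subseteq> X \<and> (\<forall>x\<in>U. \<exists>k. \<forall>y\<in>X. agree k x y \<longrightarrow> y \<in> U)"
proof
  assume "openin (subtopology (full_shift A) X) U"
  then obtain T where T: "openin (full_shift A) T" and U: "U = T \<inter> X"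
    by (auto simp: openin_subtopology)
  have "\<exists>k. \<forall>y\<in>X. agree k x y \<longrightarrow> y \<in> U" if "x \<in> U" for x
  proof -
    have "x \<in> T" using that U by simp
    then obtain V where fin: "finite {i. V i \<noteq> A}" and x: "x \<in> PiE UNIV V"
      and sub: "PiE UNIV V \<subseteq> T"
      using T unfolding full_shift_def openin_product_topology_alt by auto
    obtain k where k: "\<And>i. i \<in> {i. V i \<noteq> A} \<Longrightarrow> \<bar>i\<bar> \<le> k"
      using finite_int_abs_bound[OF fin] by blast
    have "y \<in> U" if y: "y \<in> X" "agree k x y" for y
    proof -
      have "y i \<in> V i" for i
      proof (cases "V i = A")
        case True
        then show ?thesis using y X by (auto simp: topspace_full_shift)
      next
        case False
        then have "y i = x i" using k[of i] y by (simp add: agree_def)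
        then show ?thesis using x by (auto simp: PiE_def)
      qed
      then show ?thesis using sub U y by (auto simp: PiE_def)
    qed
    then show ?thesis by blast
  qed
  then show "U \<subseteq> X \<and> (\<forall>x\<in>U. \<exists>k. \<forall>y\<in>X. agree k x y \<longrightarrow> y \<in> U)"
    using U by blast
next
  assume R: "U \<subseteq> X \<and> (\<forall>x\<in>U. \<exists>k. \<forall>y\<in>X. agree k x y \<longrightarrow> y \<in> U)"
  have "\<exists>T. openin (subtopology (full_shift A) X) T \<and> x \<in> T \<and> T \<subseteq> U" if x: "x \<in> U" for x
  proof -
    obtain k where k: "\<forall>y\<in>X. agree k x y \<longrightarrow> y \<in> U" using R x by blast
    define V where "V = PiE (UNIV::int set) (\<lambda>i. if \<bar>i\<bar> \<le> k then {x i} else A)"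
    have xA: "x i \<in> A" for i using x R X by (auto simp: topspace_full_shift)
    have "{i \<in> UNIV. (if \<bar>i\<bar> \<le> k then {x i} else A) \<noteq> A} \<subseteq> {-k..k}" by auto
    then have "finite {i \<in> UNIV. (if \<bar>i\<bar> \<le> k then {x i} else A) \<noteq> A}"
      using finite_subset by blast
    then have "openin (full_shift A) V"
      unfolding full_shift_def V_def openin_PiE_gen using xA by simp
    moreover have "x \<in> V \<inter> X" using x R xA by (auto simp: V_def)
    moreover have "V \<inter> X \<subseteq> U"
    proof
      fix y assume "y \<in> V \<inter> X"
      then have "y \<in> X" "\<And>i. y i \<in> (if \<bar>i\<bar> \<le> k then {x i} else A)"
        unfolding V_def by (simp_all add: PiE_iff)
      then show "y \<in> U" using k unfolding agree_def by (metis singletonD)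
    qed
    ultimately show ?thesis by (metis openin_subtopology_Int)
  qed
  then show "openin (subtopology (full_shift A) X) U" by (subst openin_subopen) blast
qed

lemma openin_shiftE:
  assumes "X \<subseteq> topspace (full_shift A)" and "openin (subtopology (full_shift A) X) U" and "x \<in> U"
  obtains k where "\<And>y. y \<in> X \<Longrightarrow> agree k x y \<Longrightarrow> y \<in> U"
  using assms(2,3) unfolding openin_shift_iff[OF assms(1)] by blast

lemma compact_space_full_shift: "finite A \<Longrightarrow> compact_space (full_shift A)"
  by (simp add: full_shift_def compact_space_product_topology compact_space_discrete_topology)

lemma Hausdorff_space_full_shift: "Hausdorff_space (full_shift A)"
  by (simp add: full_shift_def Hausdorff_space_product_topology Hausdorff_space_discrete_topology)

text \<open>A condition on pairs of consecutive symbols, which may depend on the position, is closed.\<close>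

lemma closedin_full_shift_local:
  "closedin (full_shift A) {x \<in> topspace (full_shift A). \<forall>i. Q i (x i) (x (i + 1))}"
proof -
  let ?T = "topspace (full_shift A)" and ?C = "{x \<in> topspace (full_shift A). \<forall>i. Q i (x i) (x (i + 1))}"
  have "openin (subtopology (full_shift A) ?T) (?T - ?C)"
  proof (intro iffD2[OF openin_shift_iff[OF subset_refl]] conjI ballI)
    show "?T - ?C \<subseteq> ?T" by blast
  next
    fix x assume "x \<in> ?T - ?C"
    then obtain i where "\<not> Q i (x i) (x (i + 1))" by blast
    moreover have "\<bar>i\<bar> \<le> \<bar>i\<bar> + 1" "\<bar>i + 1\<bar> \<le> \<bar>i\<bar> + 1" by auto
    ultimately have "\<forall>y\<in>?T. agree (\<bar>i\<bar> + 1) x y \<longrightarrow> y \<in> ?T - ?C"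
      unfolding agree_def by (metis (mono_tags, lifting) Diff_iff mem_Collect_eq)
    then show "\<exists>k. \<forall>y\<in>?T. agree k x y \<longrightarrow> y \<in> ?T - ?C" by blast
  qed
  then show ?thesis by (auto simp: closedin_def)
qed

text \<open>The finite case of the Baire category theorem, valid in every topological space.\<close>

lemma finite_Union_closed_interior:
  assumes "finite S" and "\<And>s. s \<in> S \<Longrightarrow> closedin T (C s)"
    and "openin T V" and "V \<noteq> {}" and "V \<subseteq> (\<Union>s\<in>S. C s)"
  obtains s where "s \<in> S" and "T interior_of (C s) \<noteq> {}"
proof -
  have "\<exists>s\<in>S. T interior_of (C s) \<noteq> {}"
    using assms
  proof (induction S arbitrary: V rule: finite_induct)
    case empty
    then show ?case by simp
  next
    case (insert s S)
    show ?case
    proof (cases "V \<subseteq> C s")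
      case True
      then show ?thesis using insert.prems interior_of_maximal[of V "C s" T] by blast
    next
      case False
      have "openin T (V - C s)" using insert.prems by (simp add: openin_diff)
      then have "\<exists>s\<in>S. T interior_of (C s) \<noteq> {}"
        using False insert.prems by (intro insert.IH[of "V - C s"]) auto
      then show ?thesis by blast
    qed
  qed
  then show ?thesis using that by blast
qed

section \<open>Markov shifts and presentations of irreducible sofic shifts\<close>

text \<open>
  The one-step shift of finite type over \<open>F\<close> with transition relation \<open>R\<close>. For a graph, \<open>F\<close> is
  a set of arcs, and \<open>R a b\<close> says that the arc \<open>b\<close> starts where \<open>a\<close> ends.
\<close>

definition markov_shift :: "'e set \<Rightarrow> ('e \<Rightarrow> 'e \<Rightarrow> bool) \<Rightarrow> (int \<Rightarrow> 'e) set" where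
  "markov_shift F R = {e. \<forall>i. e i \<in> F \<and> R (e i) (e (i + 1))}"

text \<open>A finite walk, given like the points of a Markov shift by its sequence of arcs. It may be empty.\<close>

definition walk :: "'e set \<Rightarrow> ('e \<Rightarrow> 'e \<Rightarrow> bool) \<Rightarrow> 'e list \<Rightarrow> bool" where
  "walk F R p \<longleftrightarrow> set p \<subseteq> F \<and> successively R p"

lemma walk_infix: "walk F R (u @ p @ v) \<Longrightarrow> walk F R p"
  by (auto simp: walk_def successively_append_iff)

lemma length_block [simp]: "length (block x i n) = n"
  by (simp add: block_def)

lemma nth_block [simp]: "k < n \<Longrightarrow> block x i n ! k = x (i + int k)"
  by (simp add: block_def)

lemma walk_block:
  assumes "e \<in> markov_shift F R"
  shows "walk F R (block e i n)"
  using assms unfolding walk_def successively_conv_nth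
  by (auto simp: block_def markov_shift_def add.assoc) (metis add.assoc add.commute)

lemma map_block: "map f (block x i n) = block (f \<circ> x) i n"
  by (simp add: block_def)

lemma closedin_markov_shift: "closedin (full_shift F) (markov_shift F R)"
proof -
  have "markov_shift F R = {x \<in> topspace (full_shift F). \<forall>i. R (x i) (x (i + 1))}"
    by (auto simp: markov_shift_def topspace_full_shift)
  then show ?thesis using closedin_full_shift_local[of F "\<lambda>_. R"] by simp
qed

text \<open>
  Koenig's lemma in topological form: the sequences whose part around \<open>{-n..n}\<close> is a walk with
  the label of \<open>x\<close> form a decreasing sequence of nonempty closed sets in a compact space.
\<close>

lemma lift_point:
  assumes fin: "finite F"
    and lift: "\<And>i n. \<exists>p. walk F R p \<and> map lab p = block x i n"
  obtains e where "e \<in> markov_shift F R" and "lab \<circ> e = x"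
proof -
  define K where "K n = {e \<in> topspace (full_shift F).
    \<forall>i. \<bar>i\<bar> \<le> int n \<longrightarrow> lab (e i) = x i \<and> R (e i) (e (i + 1))}" for n :: nat
  have "\<Inter>(range K) \<noteq> {}"
  proof (rule compact_space_imp_nest[OF compact_space_full_shift[OF fin]])
    show "closedin (full_shift F) (K n)" for n
      unfolding K_def
      by (rule closedin_full_shift_local[of F "\<lambda>i a b. \<bar>i\<bar> \<le> int n \<longrightarrow> lab a = x i \<and> R a b"])
    show "K n \<noteq> {}" for n
    proof -
      obtain p where p: "walk F R p" "map lab p = block x (- int n) (2 * n + 2)"
        using lift by blast
      have len: "length p = 2 * n + 2" using p(2) by (metis length_block length_map)
      \<comment> \<open>Outside the window, the value only has to lie in \<open>F\<close>.\<close>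
      define e where "e i = (if \<bar>i\<bar> \<le> int n + 1 then p ! nat (i + int n) else p ! 0)" for i
      have "p ! j \<in> F" if "j < 2 * n + 2" for j
        using p(1) that len by (auto simp: walk_def)
      moreover have "R (p ! j) (p ! Suc j)" if "Suc j < 2 * n + 2" for j
        using p(1) that len by (auto simp: walk_def successively_conv_nth)
      moreover have "lab (p ! j) = x (int j - int n)" if "j < 2 * n + 2" for j
        using arg_cong[OF p(2), of "\<lambda>q. q ! j"] that len by simp
      moreover have "nat (i + 1 + int n) = Suc (nat (i + int n))" if "\<bar>i\<bar> \<le> int n" for i
        using that by simp
      ultimately have "e \<in> K n"
        unfolding K_def topspace_full_shift e_def by auto
      then show ?thesis by blast
    qed
    show "decseq K" by (auto simp: decseq_def K_def)
  qed
  then obtain e where e: "\<And>n. e \<in> K n" by blast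
  have "e i \<in> F \<and> lab (e i) = x i \<and> R (e i) (e (i + 1))" for i
    using e[of "nat \<bar>i\<bar>"] by (auto simp: K_def topspace_full_shift)
  then show ?thesis by (intro that[of e]) (auto simp: markov_shift_def)
qed

text \<open>
  Irreducibility of the Markov shift, expressed on the transition relation. The walk from \<open>a\<close> to
  \<open>b\<close> has at least one transition, even when \<open>a = b\<close>.
\<close>

definition connected_walks :: "'e set \<Rightarrow> ('e \<Rightarrow> 'e \<Rightarrow> bool) \<Rightarrow> bool" where
  "connected_walks F R \<longleftrightarrow> (\<forall>a\<in>F. \<forall>b\<in>F. \<exists>p. walk F R (a # p @ [b]))"

text \<open>
  The set \<open>F\<close> is one of least cardinality in which all words of \<open>X\<close> lift to walks.
\<close>

lemma irreducible_lift:
  assumes fin: "finite E"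
    and lift: "\<And>w. w \<in> language X \<Longrightarrow> \<exists>p. walk E R p \<and> map lab p = w"
    and irr: "irreducible_shift X"
  obtains F where "F \<subseteq> E" and "connected_walks F R"
    and "\<forall>w\<in>language X. \<exists>p. walk F R p \<and> map lab p = w"
proof -
  define Q where "Q F \<longleftrightarrow> F \<subseteq> E \<and> (\<forall>w\<in>language X. \<exists>p. walk F R p \<and> map lab p = w)" for F
  have "Q E" using lift by (auto simp: Q_def)
  then obtain F where F: "Q F" and min: "\<And>F'. Q F' \<Longrightarrow> card F \<le> card F'"
    using ex_has_least_nat[of Q E card] by blast
  have finF: "finite F" using F fin finite_subset by (auto simp: Q_def)
  \<comment> \<open>The arc \<open>a\<close> cannot be discarded, so some word has no lift that avoids it.\<close>
  have force: "\<exists>w\<in>language X. \<forall>p. walk F R p \<and> map lab p = w \<longrightarrow> a \<in> set p"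
    if a: "a \<in> F" for a
  proof -
    have "card (F - {a}) < card F" using finF a by (rule card_Diff1_less)
    then have "\<not> Q (F - {a})" using min by fastforce
    then obtain w where w: "w \<in> language X" "\<not> (\<exists>p. walk (F - {a}) R p \<and> map lab p = w)"
      using F by (auto simp: Q_def)
    have "a \<in> set p" if "walk F R p" "map lab p = w" for p
      using w(2) that by (auto simp: walk_def)
    then show ?thesis using w(1) by blast
  qed
  have "\<exists>p. walk F R (a # p @ [b])" if a: "a \<in> F" and b: "b \<in> F" for a b
  proof -
    obtain u where u: "u \<in> language X" "\<And>p. walk F R p \<Longrightarrow> map lab p = u \<Longrightarrow> a \<in> set p"
      using force[OF a] by blast
    obtain v where v: "v \<in> language X" "\<And>p. walk F R p \<Longrightarrow> map lab p = v \<Longrightarrow> b \<in> set p"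
      using force[OF b] by blast
    obtain z where "u @ z @ v \<in> language X" using irr u v unfolding irreducible_shift_def by blast
    then obtain p where p: "walk F R p" "map lab p = u @ z @ v" using F by (auto simp: Q_def)
    obtain p1 q where p1: "p = p1 @ q" "map lab p1 = u" "map lab q = z @ v"
      using iffD1[OF map_eq_append_conv p(2)] by auto
    obtain p2 p3 where "q = p2 @ p3" "map lab p3 = v"
      using iffD1[OF map_eq_append_conv p1(3)] by auto
    then have ps: "p = p1 @ p2 @ p3" "map lab p1 = u" "map lab p3 = v" using p1 by auto
    have "walk F R p1" using p ps walk_infix[of F R "[]" p1 "p2 @ p3"] by simp
    then have "a \<in> set p1" using u ps by blast
    moreover have "walk F R p3" using p ps walk_infix[of F R "p1 @ p2" p3 "[]"] by simp
    then have "b \<in> set p3" using v ps by blast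
    ultimately obtain q1 r1 q3 r3 where "p1 = q1 @ a # r1" "p3 = q3 @ b # r3"
      by (meson split_list)
    then have "p = q1 @ (a # (r1 @ p2 @ q3) @ [b]) @ r3" using ps by simp
    then have "walk F R (a # (r1 @ p2 @ q3) @ [b])" using p walk_infix by metis
    then show ?thesis by blast
  qed
  then show ?thesis using that F unfolding Q_def connected_walks_def by blast
qed

lemma irreducible_sofic_presentation:
  assumes "sofic X" and irr: "irreducible_shift X"
  obtains F :: "nat set" and R lab where "finite F" and "connected_walks F R"
    and "(\<lambda>e. lab \<circ> e) ` markov_shift F R = X"
proof -
  obtain G :: "(nat, nat) pre_digraph" and lab where "fin_digraph G"
    and X: "X = {lab \<circ> e | e. biinfinite_path G e}"
    using assms by (auto simp: sofic_def)
  then interpret fin_digraph G by simp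
  define R where "R a b \<longleftrightarrow> head G a = tail G b" for a b
  have X': "X = (\<lambda>e. lab \<circ> e) ` markov_shift (arcs G) R"
    by (auto simp: X markov_shift_def biinfinite_path_def R_def)
  have lift0: "\<exists>p. walk (arcs G) R p \<and> map lab p = w" if w: "w \<in> language X" for w
  proof -
    obtain e i n where e: "e \<in> markov_shift (arcs G) R" and w: "w = block (lab \<circ> e) i n"
      using w unfolding language_def X' by blast
    show ?thesis using walk_block[OF e, of i n] by (auto simp: w map_block)
  qed
  obtain F where F: "F \<subseteq> arcs G" "connected_walks F R"
    and lift: "\<forall>w\<in>language X. \<exists>p. walk F R p \<and> map lab p = w"
    by (rule irreducible_lift[OF finite_arcs lift0 irr])
  have finF: "finite F" using F(1) finite_arcs by (rule finite_subset)
  have "(\<lambda>e. lab \<circ> e) ` markov_shift F R = X"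
  proof
    show "(\<lambda>e. lab \<circ> e) ` markov_shift F R \<subseteq> X"
      using F(1) by (auto simp: X' markov_shift_def)
    show "X \<subseteq> (\<lambda>e. lab \<circ> e) ` markov_shift F R"
    proof
      fix x assume x: "x \<in> X"
      have "\<exists>p. walk F R p \<and> map lab p = block x i n" for i n
      proof -
        have "block x i n \<in> language X" using x unfolding language_def by blast
        then show ?thesis using lift by blast
      qed
      then obtain e where "e \<in> markov_shift F R" "lab \<circ> e = x"
        by (rule lift_point[OF finF])
      then show "x \<in> (\<lambda>e. lab \<circ> e) ` markov_shift F R" by blast
    qed
  qed
  with finF F(2) show ?thesis by (rule that)
qed

lemma markov_shift_translate:
  "e \<in> markov_shift F R \<Longrightarrow> (\<lambda>i. e (i + c)) \<in> markov_shift F R"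
  by (auto simp: markov_shift_def) (metis add.assoc add.commute)

lemma markov_shift_glue:
  assumes "e \<in> markov_shift F R" and "e' \<in> markov_shift F R" and "e t = e' t"
  shows "(\<lambda>i. if i \<le> t then e i else e' i) \<in> markov_shift F R"
  unfolding markov_shift_def
proof (clarify, intro conjI)
  fix i
  show "(if i \<le> t then e i else e' i) \<in> F" using assms by (auto simp: markov_shift_def)
  consider "i < t" | "i = t" | "i > t" by linarith
  then show "R (if i \<le> t then e i else e' i) (if i + 1 \<le> t then e (i + 1) else e' (i + 1))"
    using assms by cases (auto simp: markov_shift_def)
qed

text \<open>
  A point that follows \<open>e\<close> up to position \<open>l\<close>, and from position \<open>r + d\<close> on follows a translate
  of \<open>e'\<close> from its position \<open>r\<close> on.
\<close>

lemma markov_shift_connect: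
  assumes conn: "connected_walks F R"
    and e: "e \<in> markov_shift F R" and e': "e' \<in> markov_shift F R"
  obtains g d where "g \<in> markov_shift F R" and "l < r + d"
    and "\<forall>i\<le>l. g i = e i" and "\<forall>i\<ge>r. g (i + d) = e' i"
proof -
  have "e l \<in> F" "e' r \<in> F" using e e' by (auto simp: markov_shift_def)
  then obtain p where p: "walk F R (e l # p @ [e' r])"
    using conn by (auto simp: connected_walks_def)
  define q where "q = e l # p @ [e' r]"
  define t where "t = length p + 1"
  have len: "length q = t + 1" by (simp add: q_def t_def)
  have q0: "q ! 0 = e l" and qt: "q ! t = e' r" by (simp_all add: q_def t_def nth_append)
  have t: "t > 0" by (simp add: t_def)
  define d where "d = l + int t - r"
  define g where "g i = (if i \<le> l then e i else if i \<le> l + int t then q ! nat (i - l) else e' (i - d))" for i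
  have gl: "g i = e i" if "i \<le> l" for i using that by (simp add: g_def)
  have gm: "g i = q ! nat (i - l)" if "l \<le> i" "i \<le> l + int t" for i
    using that q0 by (cases "i = l") (auto simp: g_def)
  have gr: "g i = e' (i - d)" if "l + int t \<le> i" for i
    using that qt t by (cases "i = l + int t") (auto simp: g_def d_def)
  have "g i \<in> F \<and> R (g i) (g (i + 1))" for i
  proof -
    consider "i < l" | "l \<le> i" "i < l + int t" | "l + int t \<le> i" by linarith
    then show ?thesis
    proof cases
      case 1
      then show ?thesis using gl[of i] gl[of "i + 1"] e by (auto simp: markov_shift_def)
    next
      case 2
      have "g i = q ! nat (i - l)" "g (i + 1) = q ! Suc (nat (i - l))"
        using gm[of i] gm[of "i + 1"] 2 by (auto simp: Suc_nat_eq_nat_zadd1 algebra_simps)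
      moreover have "Suc (nat (i - l)) < length q" using 2 len by linarith
      ultimately show ?thesis
        using p unfolding walk_def successively_conv_nth q_def[symmetric]
        by (metis Suc_lessD nth_mem subsetD)
    next
      case 3
      have "g (i + 1) = e' (i - d + 1)" using gr[of "i + 1"] 3 by (simp add: algebra_simps)
      then show ?thesis using gr[of i] 3 e' by (auto simp: markov_shift_def)
    qed
  qed
  then have "g \<in> markov_shift F R" by (simp add: markov_shift_def)
  moreover have "l < r + d" using t by (simp add: d_def)
  moreover have "g (i + d) = e' i" if "r \<le> i" for i
    using gr[of "i + d"] that by (simp add: d_def)
  ultimately show ?thesis using that gl by blast
qed

section \<open>Sliding block codes and semi-open maps\<close>

lemma shift_invariant_translate:
  assumes "shift ` X = X" and "x \<in> X"
  shows "(\<lambda>i. x (i + c)) \<in> X"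
proof -
  have pos: "(\<lambda>i. x (i + int n)) \<in> X" if "x \<in> X" for n x
  proof (induction n)
    case 0
    then show ?case using that by simp
  next
    case (Suc n)
    have "shift (\<lambda>i. x (i + int n)) \<in> X" using Suc assms(1) by blast
    then show ?case by (simp add: shift_def algebra_simps)
  qed
  have neg: "\<exists>y\<in>X. x = (\<lambda>i. y (i + int n))" for n
  proof (induction n)
    case 0
    then show ?case using assms(2) by auto
  next
    case (Suc n)
    then obtain y where y: "y \<in> X" "x = (\<lambda>i. y (i + int n))" by blast
    then obtain z where "z \<in> X" "y = shift z" using assms(1) by blast
    then show ?case using y by (intro bexI[of _ z]) (auto simp: shift_def algebra_simps)
  qed
  show ?thesis
  proof (cases "c \<ge> 0")
    case True
    then show ?thesis using pos[OF assms(2), of "nat c"] by simp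
  next
    case False
    obtain y where "y \<in> X" "x = (\<lambda>i. y (i + int (nat (- c))))" using neg by blast
    then show ?thesis using False by simp
  qed
qed

text \<open>
  The coordinate \<open>\<phi> x i\<close> depends only on \<open>x\<close> at the positions \<open>i - m, \<dots>, i + n\<close>, and \<open>\<phi>\<close> commutes
  with translations; the translation amount \<open>c\<close> states both at once.
\<close>

lemma code_window:
  assumes "code X Y \<phi>"
  obtains m n :: int where "0 \<le> m" and "0 \<le> n"
    and "\<And>x y i c. x \<in> X \<Longrightarrow> y \<in> X \<Longrightarrow> (\<And>j. i - m \<le> j \<Longrightarrow> j \<le> i + n \<Longrightarrow> x j = y (j + c))
      \<Longrightarrow> \<phi> x i = \<phi> y (i + c)"
proof -
  obtain m n \<Phi> where \<Phi>: "\<And>x i. x \<in> X \<Longrightarrow> \<phi> x i = \<Phi> (block x (i - int m) (m + n + 1))"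
    using assms unfolding code_def by blast
  have "\<phi> x i = \<phi> y (i + c)"
    if "x \<in> X" "y \<in> X" and eq: "\<And>j. i - int m \<le> j \<Longrightarrow> j \<le> i + int n \<Longrightarrow> x j = y (j + c)" for x y i c
  proof -
    have "block x (i - int m) (m + n + 1) = block y (i + c - int m) (m + n + 1)"
    proof (rule nth_equalityI)
      fix k assume "k < length (block x (i - int m) (m + n + 1))"
      then show "block x (i - int m) (m + n + 1) ! k = block y (i + c - int m) (m + n + 1) ! k"
        using eq[of "i - int m + int k"] by (simp add: algebra_simps)
    qed simp
    then show ?thesis using \<Phi> that by metis
  qed
  then show ?thesis using that[of "int m" "int n"] by simp
qed

lemma continuous_map_code:
  assumes X: "X \<subseteq> topspace (full_shift A)" and Y: "Y \<subseteq> topspace (full_shift B)"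
    and code: "code X Y \<phi>"
  shows "continuous_map (subtopology (full_shift A) X) (subtopology (full_shift B) Y) \<phi>"
proof -
  obtain m n where mn: "0 \<le> m" "0 \<le> n"
    and window: "\<And>x y i c. x \<in> X \<Longrightarrow> y \<in> X
      \<Longrightarrow> (\<And>j. i - m \<le> j \<Longrightarrow> j \<le> i + n \<Longrightarrow> x j = y (j + c)) \<Longrightarrow> \<phi> x i = \<phi> y (i + c)"
    using code_window[OF code] by blast
  have into: "\<phi> x \<in> Y" if "x \<in> X" for x using code that by (auto simp: code_def)
  have tops: "topspace (subtopology (full_shift A) X) = X"
    "topspace (subtopology (full_shift B) Y) = Y" using X Y by auto
  show ?thesis
    unfolding continuous_map_def tops
  proof (intro conjI allI impI)
    show "\<phi> \<in> X \<rightarrow> Y" using into by blast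
    fix V assume V: "openin (subtopology (full_shift B) Y) V"
    show "openin (subtopology (full_shift A) X) {x \<in> X. \<phi> x \<in> V}"
      unfolding openin_shift_iff[OF X]
    proof (intro conjI ballI)
      show "{x \<in> X. \<phi> x \<in> V} \<subseteq> X" by blast
      fix x assume x: "x \<in> {x \<in> X. \<phi> x \<in> V}"
      then obtain k where k: "\<And>y. y \<in> Y \<Longrightarrow> agree k (\<phi> x) y \<Longrightarrow> y \<in> V"
        using openin_shiftE[OF Y V] by blast
      have "y \<in> {x \<in> X. \<phi> x \<in> V}" if y: "y \<in> X" "agree (k + m + n) x y" for y
      proof -
        have "\<phi> x i = \<phi> y i" if "\<bar>i\<bar> \<le> k" for i
          using window[of x y i 0] x y mn that by (auto simp: agree_def)
        then show ?thesis using k[of "\<phi> y"] into y by (auto simp: agree_def)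
      qed
      then show "\<exists>k. \<forall>y\<in>X. agree k x y \<longrightarrow> y \<in> {x \<in> X. \<phi> x \<in> V}" by blast
    qed
  qed
qed

lemma semi_open_map_cancel:
  assumes f: "continuous_map S T f" "f ` topspace S = topspace T"
    and gf: "semi_open_map S Z (g \<circ> f)"
  shows "semi_open_map T Z g"
  unfolding semi_open_map_def
proof (intro allI impI, elim conjE)
  fix U assume U: "openin T U" "U \<noteq> {}"
  let ?V = "{x \<in> topspace S. f x \<in> U}"
  have "openin S ?V" using f(1) U(1) by (rule openin_continuous_map_preimage)
  moreover have img: "f ` ?V = U" using f(2) openin_subset[OF U(1)] by force
  moreover have "?V \<noteq> {}" using img U(2) by blast
  moreover have "(g \<circ> f) ` ?V = g ` U" unfolding image_comp[symmetric] img ..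
  ultimately show "Z interior_of (g ` U) \<noteq> {}"
    using gf unfolding semi_open_map_def by metis
qed

section \<open>Codes on irreducible Markov shifts\<close>

text \<open>
  The core of the argument. In the proof, \<open>g\<close> shows \<open>e0\<close> around the positions \<open>-a\<close> and \<open>b\<close>, and
  \<open>e1\<close> around \<open>0\<close>; the point \<open>h\<close> follows \<open>l\<close> up to \<open>-a\<close>, then \<open>g\<close> up to \<open>b\<close>, then \<open>r\<close>.
\<close>

lemma semi_open_map_markov_shift:
  assumes fin: "finite F" and conn: "connected_walks F R"
    and Y: "shift_space B Y" and \<pi>: "factor_code (markov_shift F R) Y \<pi>"
  shows "semi_open_map (subtopology (full_shift F) (markov_shift F R))
    (subtopology (full_shift B) Y) \<pi>"
proof -
  let ?P = "markov_shift F R"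
  let ?TP = "subtopology (full_shift F) ?P" and ?TY = "subtopology (full_shift B) Y"
  have PF: "?P \<subseteq> topspace (full_shift F)"
    by (rule closedin_subset[OF closedin_markov_shift])
  have YB: "Y \<subseteq> topspace (full_shift B)"
    using Y closedin_subset unfolding shift_space_def by blast
  have Yshift: "(\<lambda>i. y (i + c)) \<in> Y" if "y \<in> Y" for y c
    using Y that shift_invariant_translate unfolding shift_space_def by blast
  have code: "code ?P Y \<pi>" and onto: "\<pi> ` ?P = Y" using \<pi> by (auto simp: factor_code_def)
  have "compact_space ?TP"
    using closedin_compact_space[OF compact_space_full_shift[OF fin] closedin_markov_shift]
    by (rule compact_space_subtopology)
  moreover have "kc_space ?TY"
    by (intro Hausdorff_imp_kc_space Hausdorff_space_subtopology Hausdorff_space_full_shift)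
  ultimately have closed: "closed_map ?TP ?TY \<pi>"
    using continuous_map_code[OF PF YB code] by (rule continuous_imp_closed_map_gen)
  obtain m n where mn: "0 \<le> m" "0 \<le> n"
    and window: "\<And>x y i c. x \<in> ?P \<Longrightarrow> y \<in> ?P
      \<Longrightarrow> (\<And>j. i - m \<le> j \<Longrightarrow> j \<le> i + n \<Longrightarrow> x j = y (j + c)) \<Longrightarrow> \<pi> x i = \<pi> y (i + c)"
    using code_window[OF code] by blast
  \<comment> \<open>The points in state \<open>s\<close>. A state has the length of the coding window, so if two
    points in the same state are glued at position \<open>0\<close>, every window of the result is a window of
    one of them.\<close>
  define W where "W s = {e \<in> ?P. \<forall>i\<in>{- (m + n)..0}. e i = s i}" for s
  have closedW: "closedin ?TY (\<pi> ` W s)" for s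
  proof -
    have "W s = ?P \<inter> {e \<in> topspace (full_shift F). \<forall>i. i \<in> {- (m + n)..0} \<longrightarrow> e i = s i}"
      using PF by (auto simp: W_def)
    then have "closedin ?TP (W s)"
      using closedin_full_shift_local[of F "\<lambda>i a b. i \<in> {- (m + n)..0} \<longrightarrow> a = s i"]
      by (simp add: closedin_subtopology_Int_closed)
    then show ?thesis using closed by (simp add: closed_map_def)
  qed
  show ?thesis
    unfolding semi_open_map_def
  proof (intro allI impI, elim conjE)
    fix V assume V: "openin ?TP V" "V \<noteq> {}"
    then obtain e1 where e1: "e1 \<in> V" by blast
    then have e1P: "e1 \<in> ?P" using openin_subset[OF V(1)] by auto
    obtain k0 where k0: "\<And>e. e \<in> ?P \<Longrightarrow> agree k0 e1 e \<Longrightarrow> e \<in> V"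
      using openin_shiftE[OF PF V(1) e1] by blast
    define k where "k = \<bar>k0\<bar>"
    have k: "e \<in> V" if "e \<in> ?P" "\<And>i. \<bar>i\<bar> \<le> k \<Longrightarrow> e1 i = e i" for e
      using k0[of e] that by (auto simp: agree_def k_def)
    \<comment> \<open>Some \<open>\<pi>(W s)\<close> contains all points of \<open>Y\<close> near one of its points \<open>y0\<close>.\<close>
    have "Y \<subseteq> (\<Union>s\<in>PiE {- (m + n)..0} (\<lambda>_. F). \<pi> ` W s)"
    proof
      fix y assume "y \<in> Y"
      then obtain e where e: "e \<in> ?P" "y = \<pi> e" using onto by blast
      have "e \<in> W (restrict e {- (m + n)..0})" using e by (simp add: W_def)
      moreover have "restrict e {- (m + n)..0} \<in> PiE {- (m + n)..0} (\<lambda>_. F)"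
        using e by (auto simp: markov_shift_def)
      ultimately show "y \<in> (\<Union>s\<in>PiE {- (m + n)..0} (\<lambda>_. F). \<pi> ` W s)" using e by blast
    qed
    moreover have "finite (PiE {- (m + n)..0} (\<lambda>_. F))" using fin by (intro finite_PiE) auto
    moreover have "openin ?TY Y" using YB openin_topspace[of ?TY] by (simp add: inf.absorb2)
    moreover have "Y \<noteq> {}" using e1P onto by blast
    ultimately obtain s where "?TY interior_of (\<pi> ` W s) \<noteq> {}"
      using finite_Union_closed_interior[of _ ?TY "\<lambda>s. \<pi> ` W s"] closedW by metis
    then obtain y0 where y0: "y0 \<in> ?TY interior_of (\<pi> ` W s)" by blast
    then obtain L0 where L0: "\<And>y. y \<in> Y \<Longrightarrow> agree L0 y0 y \<Longrightarrow> y \<in> \<pi> ` W s"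
      using openin_shiftE[OF YB openin_interior_of y0] interior_of_subset[of ?TY "\<pi> ` W s"]
      by (metis subsetD)
    obtain e0 where e0: "e0 \<in> W s" "y0 = \<pi> e0" using subsetD[OF interior_of_subset y0] by blast
    have e0P: "e0 \<in> ?P" and e0s: "\<And>i. - (m + n) \<le> i \<Longrightarrow> i \<le> 0 \<Longrightarrow> e0 i = s i"
      using e0 by (auto simp: W_def)
    \<comment> \<open>On \<open>{-L..L}\<close>, a copy of \<open>e0\<close> determines its image on \<open>{-L0..L0}\<close> and shows its state.\<close>
    define L where "L = \<bar>L0\<bar> + m + n"
    have L: "L0 + m + n \<le> L" "m + n \<le> L" by (auto simp: L_def)
    obtain g1 a where g1: "g1 \<in> ?P" "L < - k + a" "\<forall>i\<le>L. g1 i = e0 i"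
      "\<forall>i\<ge>-k. g1 (i + a) = e1 i"
      by (rule markov_shift_connect[OF conn e0P e1P, of L "- k"])
    obtain g2 d where g2: "g2 \<in> ?P" "k + a < - L + d" "\<forall>i\<le>k + a. g2 i = g1 i"
      "\<forall>i\<ge>-L. g2 (i + d) = e0 i"
      by (rule markov_shift_connect[OF conn g1(1) e0P, of "k + a" "- L"])
    define g where "g i = g2 (i + a)" for i
    define b where "b = d - a"
    have kpos: "0 \<le> k" by (simp add: k_def)
    have a: "k + L < a" and b: "k + L < b" using g1 g2 by (auto simp: b_def)
    have gP: "g \<in> ?P" using markov_shift_translate[OF g2(1)] by (simp add: g_def[abs_def])
    have g_left: "g i = e0 (i + a)" if "i + a \<le> L" for i
      using g1(3) g2(3) that a kpos by (simp add: g_def)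
    have g_mid: "g i = e1 i" if "\<bar>i\<bar> \<le> k" for i
      using g1(4)[rule_format, of i] g2(3)[rule_format, of "i + a"] that by (simp add: g_def)
    have g_right: "g i = e0 (i - b)" if "- L \<le> i - b" for i
      using g2(4)[rule_format, OF that] by (simp add: g_def b_def)
    \<comment> \<open>Large enough for the images of both copies of \<open>e0\<close> and everything between them.\<close>
    define K where "K = a + b + n"
    define Z where "Z = {y \<in> Y. agree K (\<pi> g) y}"
    have "openin ?TY Z"
      unfolding openin_shift_iff[OF YB]
      by (auto simp: Z_def agree_def)
    moreover have "\<pi> g \<in> Z" using gP onto by (auto simp: Z_def agree_def)
    moreover have "Z \<subseteq> \<pi> ` V"
    proof
      fix y assume "y \<in> Z"
      then have y: "y \<in> Y" and yg: "\<And>i. \<bar>i\<bar> \<le> K \<Longrightarrow> \<pi> g i = y i"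
        by (auto simp: Z_def agree_def)
      \<comment> \<open>Both translates of \<open>y\<close> are near \<open>y0\<close>, so they have preimages in state \<open>s\<close>.\<close>
      have "agree L0 y0 (\<lambda>i. y (i + - a))"
        unfolding agree_def
      proof (intro allI impI)
        fix i assume i: "\<bar>i\<bar> \<le> L0"
        have "\<pi> e0 i = \<pi> g (i + - a)"
          using window[OF e0P gP, of i "- a"] g_left mn i L by simp
        also have "\<dots> = y (i + - a)" using i a b mn L kpos by (intro yg) (auto simp: K_def)
        finally show "y0 i = y (i + - a)" using e0 by simp
      qed
      then obtain f where f: "f \<in> W s" "\<pi> f = (\<lambda>i. y (i + - a))"
        using L0 Yshift[OF y, of "- a"] by force
      have "agree L0 y0 (\<lambda>i. y (i + b))"
        unfolding agree_def
      proof (intro allI impI)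
        fix i assume i: "\<bar>i\<bar> \<le> L0"
        have "\<pi> e0 i = \<pi> g (i + b)"
          using window[OF e0P gP, of i b] g_right mn i L by simp
        also have "\<dots> = y (i + b)" using i a b mn L kpos by (intro yg) (auto simp: K_def)
        finally show "y0 i = y (i + b)" using e0 by simp
      qed
      then obtain f' where f': "f' \<in> W s" "\<pi> f' = (\<lambda>i. y (i + b))"
        using L0 Yshift[OF y, of b] by force
      have fP: "f \<in> ?P" "f' \<in> ?P" using f f' by (auto simp: W_def)
      define l where "l i = f (i + a)" for i
      define r where "r i = f' (i + - b)" for i
      have lrP: "l \<in> ?P" "r \<in> ?P"
        unfolding l_def r_def by (intro markov_shift_translate fP)+
      have \<pi>l: "\<pi> l i = y i" for i
        using window[OF lrP(1) fP(1), of i a] f by (simp add: l_def)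
      have \<pi>r: "\<pi> r i = y i" for i
        using window[OF lrP(2) fP(2), of i "- b"] f' by (simp add: r_def)
      have lg: "l i = g i" if "- a - (m + n) \<le> i" "i \<le> - a" for i
        using that f(1) e0s[of "i + a"] g_left[of i] L mn by (simp add: l_def W_def)
      have rg: "r i = g i" if "b - (m + n) \<le> i" "i \<le> b" for i
        using that f'(1) e0s[of "i - b"] g_right[of i] L mn by (simp add: r_def W_def)
      define h where "h i = (if i \<le> - a then l i else if i \<le> b then g i else r i)" for i
      have "(\<lambda>i. if i \<le> b then g i else r i) \<in> ?P"
        using rg[of b] mn by (intro markov_shift_glue gP lrP) simp
      then have hP: "h \<in> ?P"
        unfolding h_def[abs_def] using lg[of "- a"] mn a b L kpos
        by (intro markov_shift_glue[OF lrP(1)]) auto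
      have \<pi>h: "\<pi> h i = y i" for i
      proof -
        consider "i + n \<le> - a" | "- a < i + n" "i + n \<le> b" | "b < i + n" by linarith
        then show ?thesis
        \<comment> \<open>The window at \<open>i\<close> lies left of the first gluing position, between the two or to the
          right of the second, up to overlaps in which the glued points coincide.\<close>
        proof cases
          case 1
          then have "\<pi> h i = \<pi> l (i + 0)" by (intro window hP lrP) (simp add: h_def)
          then show ?thesis by (simp add: \<pi>l)
        next
          case 2
          then have "\<pi> h i = \<pi> g (i + 0)"
            by (intro window hP gP) (simp add: h_def lg)
          then show ?thesis using 2 yg[of i] a b mn L kpos by (simp add: K_def)
        next
          case 3
          then have "\<pi> h i = \<pi> r (i + 0)"
            using a b L kpos mn by (intro window hP lrP) (simp add: h_def rg)
          then show ?thesis by (simp add: \<pi>r)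
        qed
      qed
      have "h \<in> V"
        using a b L mn by (intro k[OF hP]) (auto simp: h_def g_mid)
      moreover have "y = \<pi> h" using \<pi>h by (intro ext) simp
      ultimately show "y \<in> \<pi> ` V" by blast
    qed
    ultimately show "?TY interior_of (\<pi> ` V) \<noteq> {}"
      using interior_of_maximal[of Z "\<pi> ` V" ?TY] by blast
  qed
qed

theorem corollary3p11:
  fixes A :: "'a set" and B :: "'b set"
    and X :: "(int \<Rightarrow> 'a) set" and Y :: "(int \<Rightarrow> 'b) set"
    and \<phi> :: "(int \<Rightarrow> 'a) \<Rightarrow> int \<Rightarrow> 'b"
  assumes "shift_space A X" and "sofic X" and "irreducible_shift X"
    and "shift_space B Y" and "factor_code X Y \<phi>"
  shows "semi_open_map (subtopology (full_shift A) X) (subtopology (full_shift B) Y) \<phi>"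
proof -
  obtain F :: "nat set" and R lab where fin: "finite F" and conn: "connected_walks F R"
    and img: "(\<lambda>e. lab \<circ> e) ` markov_shift F R = X"
    by (rule irreducible_sofic_presentation[OF assms(2,3)])
  let ?P = "markov_shift F R"
  have PF: "?P \<subseteq> topspace (full_shift F)"
    by (rule closedin_subset[OF closedin_markov_shift])
  have XA: "X \<subseteq> topspace (full_shift A)"
    using assms(1) closedin_subset unfolding shift_space_def by blast
  have "(lab \<circ> e) i = lab (hd (block e (i - int 0) (0 + 0 + 1)))" for e :: "int \<Rightarrow> nat" and i
    by (simp add: block_def)
  then have "code ?P X (\<lambda>e. lab \<circ> e)"
    unfolding code_def using img
    by (intro conjI exI[of _ 0] exI[of _ "\<lambda>w. lab (hd w)"]) auto
  then have cont: "continuous_map (subtopology (full_shift F) ?P) (subtopology (full_shift A) X)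
      (\<lambda>e. lab \<circ> e)"
    by (rule continuous_map_code[OF PF XA])
  obtain m n \<Phi> where \<Phi>: "\<forall>x\<in>X. \<forall>i. \<phi> x i = \<Phi> (block x (i - int m) (m + n + 1))"
    using assms(5) unfolding factor_code_def code_def by (elim conjE exE)
  have onto: "(\<phi> \<circ> (\<lambda>e. lab \<circ> e)) ` ?P = Y"
    using assms(5) unfolding factor_code_def image_comp[symmetric] img by (rule conjunct2)
  have "(\<phi> \<circ> (\<lambda>e. lab \<circ> e)) e i = (\<Phi> \<circ> map lab) (block e (i - int m) (m + n + 1))"
    if e: "e \<in> ?P" for e i
  proof -
    have "lab \<circ> e \<in> X" using imageI[OF e, of "\<lambda>e. lab \<circ> e"] unfolding img .
    then show ?thesis using \<Phi> by (simp add: map_block)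
  qed
  then have "\<forall>e\<in>?P. \<forall>i. (\<phi> \<circ> (\<lambda>e. lab \<circ> e)) e i
      = (\<Phi> \<circ> map lab) (block e (i - int m) (m + n + 1))"
    by (intro ballI allI)
  then have "factor_code ?P Y (\<phi> \<circ> (\<lambda>e. lab \<circ> e))"
    unfolding factor_code_def code_def using onto by (intro conjI exI) (rule eq_refl)
  then have "semi_open_map (subtopology (full_shift F) ?P) (subtopology (full_shift B) Y)
      (\<phi> \<circ> (\<lambda>e. lab \<circ> e))"
    by (rule semi_open_map_markov_shift[OF fin conn assms(4)])
  then show ?thesis
  proof (rule semi_open_map_cancel[OF cont, rotated])
    show "(\<lambda>e. lab \<circ> e) ` topspace (subtopology (full_shift F) ?P)
        = topspace (subtopology (full_shift A) X)"
      using PF XA img by (simp add: inf.absorb2)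
  qed
qed

end
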